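(* There exists a universal constant $C>0$ such that for every natural number $n\ge2$ there exists a quantum probability distribution $P$ with $\big[2^{\frac{\log^2n}{2}}\big]^n$ inputs per site, $n+1$ outputs per site and Hilbert spaces $H_1,H_2$ of dimension $n$ which can withstand any local noise with an extra output and relative strength up to $1-C\frac{\log^2n}{\sqrt n}$, i.e. $$\pi(\tilde P)\ \le\ C\,\frac{\log^2n}{\sqrt n},$$ where $\tilde P$ is $P$ regarded as a distribution with $n+2$ outputs per site.
   Context: $\log$ denotes the logarithm in base $2$. For a real number $x$, $[x]$ denotes the smallest natural number $p$ with $x\le p$. For $N$ inputs and $K$ outputs per site consider families $P=(P(a,b|x,y))$, $x,y\in\{1,\dots,N\}$, $a,b\in\{1,\dots,K\}$. $\mathcal{L}_K$ (classical or local distributions with $K$ outputs; $N$ fixed) is the set of $P$ of the form $P(a,b|x,y)=\int_\Omega P_\omega(a|x)Q_\omega(b|y)\,d\mathbb{P}(\omega)$, where $(\Omega,\mathbb{P})$ is a probability space, $P_\omega(a|x)\ge0$, $\sum_aP_\omega(a|x)=1$ for all $x,\omega$, and analogously for $Q_\omega(b|y)$. $P$ is quantum, with Hilbert spaces $H_1,H_2$, if $P(a,b|x,y)=\mathrm{tr}\big((E_x^a\otimes F_y^b)\rho\big)$, where $\rho$ is a density operator on $H_1\otimes H_2$, $E_x^a\in B(H_1)$, $F_y^b\in B(H_2)$ are positive semidefinite, $\sum_aE_x^a=\mathbb{1}$ for every $x$ and $\sum_bF_y^b=\mathbb{1}$ for every $y$. If $P$ has $K$ outputs, $\tilde P$ denotes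 the distribution with $K+1$ outputs per site with $\tilde P(a,b|x,y)=P(a,b|x,y)$ for $a,b\le K$ and $\tilde P(a,b|x,y)=0$ if $a=K+1$ or $b=K+1$. Define $$\pi(\tilde P)=\inf\{\pi\in[0,1]:\ \text{for all }P'\in\mathcal{L}_{K+1},\ \pi\tilde P+(1-\pi)P'\notin\mathcal{L}_{K+1}\},$$ with the convention $\inf\emptyset=1$. Here $1-\pi$ is the relative strength of the local noise $P'$, which may use the extra output. *)

theory Defs
  imports "HOL-Probability.Probability" "Jordan_Normal_Form.Matrix"
begin

definition nat_ceil :: "real \<Rightarrow> nat" where
  "nat_ceil x = (LEAST p. x \<le> real p)"

text \<open>
  A family \<open>P(a,b|x,y)\<close> is written \<open>P a b x y\<close>. Inputs range over \<open>{1..N}\<close> and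
  outputs over \<open>{1..K}\<close>; values outside these ranges are never constrained or used.
\<close>

type_synonym family = "nat \<Rightarrow> nat \<Rightarrow> nat \<Rightarrow> nat \<Rightarrow> real"


subsection \<open>Local distributions\<close>

definition response :: "'w measure \<Rightarrow> nat \<Rightarrow> nat \<Rightarrow> (nat \<Rightarrow> nat \<Rightarrow> 'w \<Rightarrow> real) \<Rightarrow> bool" where
  "response M N K p \<longleftrightarrow>
     (\<forall>x\<in>{1..N}. \<forall>a\<in>{1..K}. p a x \<in> borel_measurable M \<and> (\<forall>\<omega>\<in>space M. 0 \<le> p a x \<omega>)) \<and>
     (\<forall>x\<in>{1..N}. \<forall>\<omega>\<in>space M. (\<Sum>a\<in>{1..K}. p a x \<omega>) = 1)"

definition local_over :: "'w measure \<Rightarrow> nat \<Rightarrow> nat \<Rightarrow> family \<Rightarrow> bool" where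
  "local_over M N K P \<longleftrightarrow> prob_space M \<and>
     (\<exists>p q. response M N K p \<and> response M N K q \<and>
        (\<forall>x\<in>{1..N}. \<forall>y\<in>{1..N}. \<forall>a\<in>{1..K}. \<forall>b\<in>{1..K}.
           P a b x y = (\<integral>\<omega>. p a x \<omega> * q b y \<omega> \<partial>M)))"

text \<open>
  A definition cannot quantify over the type of sample points, so the sample space is
  taken on the type of real numbers. Lemma \<open>local_over_imp_local\<close> below shows that
  probability spaces on arbitrary types give no further distributions.
\<close>

definition local_dists :: "nat \<Rightarrow> nat \<Rightarrow> family set" where
  "local_dists N K = {P. \<exists>M :: real measure. local_over M N K P}"


subsection \<open>Quantum distributions\<close>

definition psd_mat :: "nat \<Rightarrow> complex mat \<Rightarrow> bool" where
  \<comment> \<open>\<open>0 \<le> z\<close> for complex \<open>z\<close> means that \<open>z\<close> is real and nonnegative\<close>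
  "psd_mat d A \<longleftrightarrow> A \<in> carrier_mat d d \<and> (\<forall>v\<in>carrier_vec d. 0 \<le> (A *\<^sub>v v) \<bullet>c v)"

definition mat_trace :: "complex mat \<Rightarrow> complex" where
  "mat_trace A = (\<Sum>i<dim_row A. A $$ (i, i))"

definition density_mat :: "nat \<Rightarrow> complex mat \<Rightarrow> bool" where
  "density_mat d \<rho> \<longleftrightarrow> psd_mat d \<rho> \<and> mat_trace \<rho> = 1"

text \<open>
  Kronecker product: the basis vector \<open>e\<^sub>i \<otimes> e\<^sub>j\<close> of the tensor product of
  \<open>d\<^sub>1\<close>- and \<open>d\<^sub>2\<close>-dimensional spaces has index \<open>i * d\<^sub>2 + j\<close>.
\<close>

definition kron :: "complex mat \<Rightarrow> complex mat \<Rightarrow> complex mat" where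
  "kron A B = mat (dim_row A * dim_row B) (dim_col A * dim_col B)
     (\<lambda>(i, j). A $$ (i div dim_row B, j div dim_col B) * B $$ (i mod dim_row B, j mod dim_col B))"

definition povm :: "nat \<Rightarrow> nat \<Rightarrow> (nat \<Rightarrow> complex mat) \<Rightarrow> bool" where
  "povm d K E \<longleftrightarrow> (\<forall>a\<in>{1..K}. psd_mat d (E a)) \<and>
     mat d d (\<lambda>(i, j). \<Sum>a\<in>{1..K}. E a $$ (i, j)) = 1\<^sub>m d"

text \<open>The Hilbert spaces of dimension \<open>d\<^sub>1\<close> and \<open>d\<^sub>2\<close> are taken in orthonormal coordinates.\<close>

definition quantum_dist :: "nat \<Rightarrow> nat \<Rightarrow> nat \<Rightarrow> nat \<Rightarrow> family \<Rightarrow> bool" where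
  "quantum_dist N K d\<^sub>1 d\<^sub>2 P \<longleftrightarrow>
     (\<exists>E F \<rho>. density_mat (d\<^sub>1 * d\<^sub>2) \<rho> \<and>
        (\<forall>x\<in>{1..N}. povm d\<^sub>1 K (E x)) \<and> (\<forall>y\<in>{1..N}. povm d\<^sub>2 K (F y)) \<and>
        (\<forall>x\<in>{1..N}. \<forall>y\<in>{1..N}. \<forall>a\<in>{1..K}. \<forall>b\<in>{1..K}.
           complex_of_real (P a b x y) = mat_trace (kron (E x a) (F y b) * \<rho>)))"


subsection \<open>Resistance to local noise\<close>

definition extend_outputs :: "nat \<Rightarrow> family \<Rightarrow> family" where
  "extend_outputs K P = (\<lambda>a b x y. if a \<in> {1..K} \<and> b \<in> {1..K} then P a b x y else 0)"

definition mix :: "real \<Rightarrow> family \<Rightarrow> family \<Rightarrow> family" where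
  "mix t P P' = (\<lambda>a b x y. t * P a b x y + (1 - t) * P' a b x y)"

text \<open>
  Here \<open>K\<close> is the number of outputs of \<open>P\<close> itself, so for an extended distribution it
  includes the extra output. The real infimum of the empty set is unspecified in HOL,
  hence the explicit case.
\<close>

definition nonlocal_threshold :: "nat \<Rightarrow> nat \<Rightarrow> family \<Rightarrow> real" where
  "nonlocal_threshold N K P =
     (let S = {t \<in> {0..1}. \<forall>P'\<in>local_dists N K. mix t P P' \<notin> local_dists N K}
      in if S = {} then 1 else Inf S)"


subsection \<open>The type of sample points is immaterial\<close>

lemma response_expand:
  assumes R: "response M N K p" and w: "\<omega> \<in> space M" and x: "x \<in> {1..N}" and a: "a \<in> {1..K}"
  shows "p a x \<omega> = (\<Sum>f\<in>{1..N} \<rightarrow>\<^sub>E {1..K}. of_bool (f x = a) * (\<Prod>z\<in>{1..N}. p (f z) z \<omega>))"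
proof -
  define r where "r z c = (if z = x then of_bool (c = a) else 1) * p c z \<omega>" for z c
  have s1: "(\<Sum>c\<in>{1..K}. p c z \<omega>) = 1" if "z \<in> {1..N}" for z
    using R w that by (auto simp: response_def)
  have "(\<Sum>f\<in>{1..N} \<rightarrow>\<^sub>E {1..K}. of_bool (f x = a) * (\<Prod>z\<in>{1..N}. p (f z) z \<omega>))
      = (\<Sum>f\<in>{1..N} \<rightarrow>\<^sub>E {1..K}. \<Prod>z\<in>{1..N}. r z (f z))"
    unfolding r_def prod.distrib using x
    by (intro sum.cong refl arg_cong2[where f = "(*)"]) (simp add: prod.delta)
  also have "\<dots> = (\<Prod>z\<in>{1..N}. \<Sum>c\<in>{1..K}. r z c)"
    by (rule prod_sum_PiE[symmetric]) auto
  also have "\<dots> = (\<Prod>z\<in>{1..N}. if z = x then p a x \<omega> else 1)"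
  proof (rule prod.cong[OF refl])
    fix z assume z: "z \<in> {1..N}"
    show "(\<Sum>c\<in>{1..K}. r z c) = (if z = x then p a x \<omega> else 1)"
    proof (cases "z = x")
      case True
      have "(\<Sum>c\<in>{1..K}. r z c) = (\<Sum>c\<in>{1..K}. if c = a then p a x \<omega> else 0)"
        using True by (intro sum.cong) (auto simp: r_def)
      then show ?thesis using True a by simp
    next
      case False
      then show ?thesis using s1[OF z] by (simp add: r_def)
    qed
  qed
  also have "\<dots> = p a x \<omega>" using x by (simp add: prod.delta)
  finally show ?thesis by simp
qed

lemma local_over_imp_local:
  fixes M :: "'w measure"
  assumes "local_over M N K P"
  shows "P \<in> local_dists N K"
proof -
  interpret prob_space M using assms by (simp add: local_over_def)
  obtain p q where p: "response M N K p" and q: "response M N K q"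
    and P: "\<And>x y a b. x \<in> {1..N} \<Longrightarrow> y \<in> {1..N} \<Longrightarrow> a \<in> {1..K} \<Longrightarrow> b \<in> {1..K} \<Longrightarrow>
      P a b x y = (\<integral>\<omega>. p a x \<omega> * q b y \<omega> \<partial>M)"
    using assms by (auto simp: local_over_def)
  define F where "F = ({1..N} \<rightarrow>\<^sub>E {1..K} :: (nat \<Rightarrow> nat) set)"
  have finF: "finite F" by (auto simp: F_def intro: finite_PiE)
  define u where "u s f \<omega> = (\<Prod>z\<in>{1..N}. s (f z) z \<omega>)"
    for s :: "nat \<Rightarrow> nat \<Rightarrow> 'w \<Rightarrow> real" and f :: "nat \<Rightarrow> nat" and \<omega>
  have u0: "0 \<le> u s f \<omega>" if "response M N K s" "f \<in> F" "\<omega> \<in> space M" for s f \<omega>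
    unfolding u_def using that by (intro prod_nonneg) (force simp: response_def F_def PiE_def Pi_def)
  have usum: "(\<Sum>f\<in>F. u s f \<omega>) = 1" if "response M N K s" "\<omega> \<in> space M" for s \<omega>
  proof -
    have "(\<Sum>f\<in>F. u s f \<omega>) = (\<Prod>z\<in>{1..N}. \<Sum>c\<in>{1..K}. s c z \<omega>)"
      unfolding F_def u_def by (rule prod_sum_PiE[symmetric]) auto
    also have "\<dots> = 1" using that by (intro prod.neutral) (auto simp: response_def)
    finally show ?thesis .
  qed
  have u1: "u s f \<omega> \<le> 1" if "response M N K s" "f \<in> F" "\<omega> \<in> space M" for s f \<omega>
    using member_le_sum[of f F "\<lambda>f. u s f \<omega>"] usum[OF that(1,3)] u0[OF that(1) _ that(3)] that(2) finF
    by auto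
  have um: "u s f \<in> borel_measurable M" if "response M N K s" "f \<in> F" for s f
  proof -
    have "s (f z) z \<in> borel_measurable M" if "z \<in> {1..N}" for z
      using \<open>response M N K s\<close> \<open>f \<in> F\<close> that
      by (auto simp: response_def F_def PiE_def Pi_def)
    then have "(\<lambda>\<omega>. \<Prod>z\<in>{1..N}. s (f z) z \<omega>) \<in> borel_measurable M"
      by (intro borel_measurable_prod) auto
    then show ?thesis by (simp add: u_def[abs_def])
  qed
  have int: "integrable M (\<lambda>\<omega>. u p f \<omega> * u q g \<omega>)" if "f \<in> F" "g \<in> F" for f g
  proof (rule integrable_const_bound[where B = 1])
    show "AE \<omega> in M. norm (u p f \<omega> * u q g \<omega>) \<le> 1"
      using u0[OF p that(1)] u1[OF p that(1)] u0[OF q that(2)] u1[OF q that(2)]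
      by (intro AE_I2) (auto simp: abs_mult intro!: mult_le_one)
    show "(\<lambda>\<omega>. u p f \<omega> * u q g \<omega>) \<in> borel_measurable M"
      using um[OF p that(1)] um[OF q that(2)] by (rule borel_measurable_times)
  qed
  define W where "W f g = (\<integral>\<omega>. u p f \<omega> * u q g \<omega> \<partial>M)" for f g
  have W0: "0 \<le> W f g" if "f \<in> F" "g \<in> F" for f g
    unfolding W_def using u0[OF p that(1)] u0[OF q that(2)]
    by (intro Bochner_Integration.integral_nonneg) auto
  have comb: "(\<integral>\<omega>. (\<Sum>f\<in>F. c f * u p f \<omega>) * (\<Sum>g\<in>F. d g * u q g \<omega>) \<partial>M)
      = (\<Sum>f\<in>F. \<Sum>g\<in>F. c f * d g * W f g)" for c d :: "(nat \<Rightarrow> nat) \<Rightarrow> real"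
  proof -
    have "(\<integral>\<omega>. (\<Sum>f\<in>F. c f * u p f \<omega>) * (\<Sum>g\<in>F. d g * u q g \<omega>) \<partial>M)
       = (\<integral>\<omega>. (\<Sum>f\<in>F. \<Sum>g\<in>F. c f * d g * (u p f \<omega> * u q g \<omega>)) \<partial>M)"
      by (simp add: sum_product mult_ac)
    also have "\<dots> = (\<Sum>f\<in>F. \<integral>\<omega>. (\<Sum>g\<in>F. c f * d g * (u p f \<omega> * u q g \<omega>)) \<partial>M)"
      by (rule Bochner_Integration.integral_sum)
         (intro Bochner_Integration.integrable_sum integrable_mult_right int)
    also have "\<dots> = (\<Sum>f\<in>F. \<Sum>g\<in>F. c f * d g * W f g)"
      unfolding W_def
      by (intro sum.cong refl, subst Bochner_Integration.integral_sum)
         (auto intro!: integrable_mult_right int)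
    finally show ?thesis .
  qed
  have Wsum: "(\<Sum>f\<in>F. \<Sum>g\<in>F. W f g) = 1"
  proof -
    have "(\<Sum>f\<in>F. \<Sum>g\<in>F. W f g) = (\<integral>\<omega>. (\<Sum>f\<in>F. 1 * u p f \<omega>) * (\<Sum>g\<in>F. 1 * u q g \<omega>) \<partial>M)"
      by (subst comb) simp
    also have "\<dots> = (\<integral>\<omega>. 1 \<partial>M)"
      by (intro Bochner_Integration.integral_cong) (auto simp: usum[OF p] usum[OF q])
    finally show ?thesis by (simp add: prob_space)
  qed
  then obtain f0 where f0: "f0 \<in> F" by (cases "F = {}") auto
  define V where "V z = (if z \<in> F \<times> F then W (fst z) (snd z) else 0)" for z
  define D where "D = embed_pmf V"
  have pmfD: "pmf D z = V z" for z
  proof -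
    have "(\<integral>\<^sup>+z. ennreal (V z) \<partial>count_space UNIV) = (\<Sum>z\<in>F \<times> F. ennreal (V z))"
      using finF by (intro nn_integral_count_space'[where A = "F \<times> F"]) (auto simp: V_def)
    also have "\<dots> = ennreal (\<Sum>z\<in>F \<times> F. V z)"
      by (rule sum_ennreal) (auto simp: V_def W0)
    also have "(\<Sum>z\<in>F \<times> F. V z) = (\<Sum>f\<in>F. \<Sum>g\<in>F. W f g)"
      by (simp add: sum.cartesian_product V_def case_prod_beta)
    finally have "(\<integral>\<^sup>+z. ennreal (V z) \<partial>count_space UNIV) = 1" using Wsum by simp
    then show ?thesis unfolding D_def by (intro pmf_embed_pmf) (auto simp: V_def W0)
  qed
  define h where "h = (\<lambda>z. real (to_nat_on (F \<times> F) z))"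
  have inj: "inj_on h (F \<times> F)"
    using inj_on_to_nat_on[of "F \<times> F"] finF by (auto simp: h_def inj_on_def countable_finite)
  define e where "e r = (if r \<in> h ` (F \<times> F) then inv_into (F \<times> F) h r else (f0, f0))" for r
  have eF: "fst (e r) \<in> F" "snd (e r) \<in> F" for r
    using inv_into_into[of r h "F \<times> F"] f0 by (auto simp: e_def mem_Times_iff)
  have eh: "e (h z) = z" if "z \<in> F \<times> F" for z
    using that inj by (simp add: e_def)
  define p' :: "nat \<Rightarrow> nat \<Rightarrow> real \<Rightarrow> real" where "p' a x r = of_bool (fst (e r) x = a)" for a x r
  define q' :: "nat \<Rightarrow> nat \<Rightarrow> real \<Rightarrow> real" where "q' a x r = of_bool (snd (e r) x = a)" for a x r
  define M' where "M' = measure_pmf (map_pmf h D)"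
  have one: "(\<Sum>a\<in>{1..K}. of_bool (f x = a)) = (1::real)" if "f \<in> F" "x \<in> {1..N}" for f x
  proof -
    have "f x \<in> {1..K}" using that by (auto simp: F_def)
    then show ?thesis by (simp add: of_bool_def sum.delta)
  qed
  have "response M' N K p'" "response M' N K q'"
    using one eF by (auto simp: response_def p'_def q'_def M'_def)
  moreover have "P a b x y = (\<integral>r. p' a x r * q' b y r \<partial>M')"
    if xy: "x \<in> {1..N}" "y \<in> {1..N}" "a \<in> {1..K}" "b \<in> {1..K}" for x y a b
  proof -
    have "(\<integral>r. p' a x r * q' b y r \<partial>M') = (\<integral>z. p' a x (h z) * q' b y (h z) \<partial>measure_pmf D)"
      by (simp add: M'_def)
    also have "\<dots> = (\<Sum>z\<in>F \<times> F. p' a x (h z) * q' b y (h z) * pmf D z)"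
      using finF
      by (intro integral_measure_pmf_real) (auto simp: set_pmf_iff pmfD V_def split: if_splits)
    also have "\<dots> = (\<Sum>f\<in>F. \<Sum>g\<in>F. of_bool (f x = a) * of_bool (g y = b) * W f g)"
      unfolding sum.cartesian_product
      by (intro sum.cong refl) (auto simp: p'_def q'_def eh pmfD V_def)
    also have "\<dots> = (\<integral>\<omega>. (\<Sum>f\<in>F. of_bool (f x = a) * u p f \<omega>) *
        (\<Sum>g\<in>F. of_bool (g y = b) * u q g \<omega>) \<partial>M)"
      by (rule comb[symmetric])
    also have "\<dots> = (\<integral>\<omega>. p a x \<omega> * q b y \<omega> \<partial>M)"
      using response_expand[OF p _ xy(1,3)] response_expand[OF q _ xy(2,4)]
      by (intro Bochner_Integration.integral_cong) (auto simp: F_def u_def)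
    finally show ?thesis using P[OF xy] by simp
  qed
  moreover have "prob_space M'" by (simp add: M'_def prob_space_measure_pmf)
  ultimately have "local_over M' N K P" unfolding local_over_def by blast
  then show ?thesis by (auto simp: local_dists_def)
qed

end

theory Submission
  imports Defs
begin

text \<open>
  A variant of the Khot--Vishnoi game. For a power of two \<open>m\<close> with \<open>m \<le> n < 2 * m\<close>, two players
  receive noisy copies of the same random vertex of the cube \<open>{1,-1}\<^sup>m\<close>, each displaced by a
  random row of a Hadamard matrix, and win if both name their row. Measuring a maximally entangled state in
  the Hadamard basis twisted by the question wins with constant probability,
  while a classical strategy corresponds to functions of mean \<open>1/m\<close> on the cube, for which the
  (2,4)-hypercontractive inequality bounds the winning probability by \<open>1/sqrt m\<close>. The winning
  probability is a nonnegative functional, so admixed noise cannot lower it below the quantum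
  share, whatever outputs the noise uses.
\<close>

section \<open>Noise on the cube\<close>

text \<open>The probability of passing from \<open>U\<close> to \<open>V\<close> when each
  coordinate of \<open>I\<close> is flipped independently with probability 1/4. The resulting
  correlation per coordinate is 3/4 - 1/4 = 1/2.\<close>

definition noise :: "'a set \<Rightarrow> 'a set \<Rightarrow> 'a set \<Rightarrow> real" where
  "noise I U V = (\<Prod>i\<in>I. if (i \<in> U) = (i \<in> V) then 3/4 else 1/4)"

text \<open>The noise operator of correlation 1/2 on functions on the cube, that is, averaging
  against the kernel \<open>noise\<close>.\<close>

definition smooth :: "'a set \<Rightarrow> ('a set \<Rightarrow> real) \<Rightarrow> 'a set \<Rightarrow> real" where
  "smooth I f U = (\<Sum>V\<in>Pow I. noise I U V * f V)"

definition sign_at :: "'a set \<Rightarrow> 'a \<Rightarrow> real" where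
  "sign_at U i = (if i \<in> U then -1 else 1)"

lemma sum_Pow_insert:
  fixes f :: "'a set \<Rightarrow> 'b::comm_monoid_add"
  assumes "finite I" "i \<notin> I"
  shows "(\<Sum>V\<in>Pow (insert i I). f V) = (\<Sum>V\<in>Pow I. f V) + (\<Sum>V\<in>Pow I. f (insert i V))"
proof -
  have "inj_on (insert i) (Pow I)"
    using assms by (auto simp: inj_on_def dest!: insert_ident[THEN iffD1, rotated 2])
  moreover have "Pow I \<inter> insert i ` Pow I = {}"
    using assms by auto
  ultimately show ?thesis
    using assms by (simp add: Pow_insert sum.union_disjoint sum.reindex)
qed

text \<open>Expanding the product of binomials picks one of the two summands at each coordinate, and
  the choices are the subsets of \<open>I\<close>. This reduces sums over the cube to single
  coordinates.\<close>

lemma sum_Pow_prod: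
  fixes g :: "'a \<Rightarrow> bool \<Rightarrow> real"
  assumes "finite I"
  shows "(\<Sum>V\<in>Pow I. \<Prod>i\<in>I. g i (i \<in> V)) = (\<Prod>i\<in>I. g i True + g i False)"
  using assms
proof (induction I)
  case empty
  then show ?case by simp
next
  case (insert j I)
  have "(\<Prod>i\<in>I. g i (i \<in> insert j V)) = (\<Prod>i\<in>I. g i (i \<in> V))" for V
    using insert.hyps by (intro prod.cong arg_cong2[where f = g] refl) auto
  moreover have "(\<Sum>V\<in>Pow I. g j (j \<in> V) * (\<Prod>i\<in>I. g i (i \<in> V)))
      = (\<Sum>V\<in>Pow I. g j False * (\<Prod>i\<in>I. g i (i \<in> V)))"
    using insert.hyps by (intro sum.cong refl arg_cong2[where f = "(*)"] arg_cong2[where f = g]) auto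
  ultimately show ?case
    using insert by (simp add: sum_Pow_insert sum_distrib_left[symmetric] algebra_simps)
qed

lemma noise_nonneg: "0 \<le> noise I U V"
  unfolding noise_def by (intro prod_nonneg) auto

lemma noise_commute: "noise I U V = noise I V U"
  unfolding noise_def by (intro prod.cong) auto

lemma sum_noise:
  assumes "finite I"
  shows "(\<Sum>V\<in>Pow I. noise I U V) = 1"
  unfolding noise_def
  using sum_Pow_prod[OF assms, of "\<lambda>i b. if (i \<in> U) = b then 3/4 else 1/4"]
  by (auto intro!: prod.neutral)

text \<open>The coordinate signs are eigenvectors of the noise operator with eigenvalue 1/2. The
  sign is absorbed into factor \<open>j\<close> of the kernel; every other factor sums to 1.\<close>

lemma sum_noise_sign:
  assumes "finite I" "j \<in> I"
  shows "(\<Sum>V\<in>Pow I. noise I U V * sign_at V j) = sign_at U j / 2"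
proof -
  let ?g = "\<lambda>i b. (if (i \<in> U) = b then 3/4 else 1/4) * (if i = j \<and> b then -1 else (1::real))"
  have "noise I U V * sign_at V j = (\<Prod>i\<in>I. ?g i (i \<in> V))" for V
  proof -
    have "(\<Prod>i\<in>I. if i = j \<and> i \<in> V then -1 else (1::real)) = (\<Prod>i\<in>I. if i = j then sign_at V j else 1)"
      by (intro prod.cong) (auto simp: sign_at_def)
    then show ?thesis
      using assms unfolding prod.distrib noise_def by simp
  qed
  then have "(\<Sum>V\<in>Pow I. noise I U V * sign_at V j) = (\<Prod>i\<in>I. ?g i True + ?g i False)"
    using sum_Pow_prod[OF assms(1), of ?g] by simp
  also have "\<dots> = (\<Prod>i\<in>I. if i = j then sign_at U j / 2 else 1)"
    by (intro prod.cong) (auto simp: sign_at_def)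
  finally show ?thesis using assms by simp
qed

lemma smooth_add: "smooth I (\<lambda>V. f V + g V) U = smooth I f U + smooth I g U"
  by (simp add: smooth_def algebra_simps sum.distrib)

lemma smooth_cmult: "smooth I (\<lambda>V. c * f V) U = c * smooth I f U"
  by (simp add: smooth_def algebra_simps sum_distrib_left)

lemma smooth_self_adjoint:
  "(\<Sum>U\<in>Pow I. f U * smooth I g U) = (\<Sum>U\<in>Pow I. smooth I f U * g U)"
proof -
  have "(\<Sum>U\<in>Pow I. f U * smooth I g U) = (\<Sum>U\<in>Pow I. \<Sum>V\<in>Pow I. f U * (noise I U V * g V))"
    by (simp add: smooth_def sum_distrib_left)
  also have "\<dots> = (\<Sum>V\<in>Pow I. \<Sum>U\<in>Pow I. f U * (noise I U V * g V))"
    by (rule sum.swap)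
  also have "\<dots> = (\<Sum>V\<in>Pow I. smooth I f V * g V)"
    unfolding smooth_def sum_distrib_right
    by (intro sum.cong refl) (simp add: noise_commute)
  finally show ?thesis .
qed

lemma noise_insert:
  assumes "finite I" "i \<notin> I" "U \<subseteq> I" "V \<subseteq> I"
  shows "noise (insert i I) U V = 3/4 * noise I U V"
    and "noise (insert i I) (insert i U) V = 1/4 * noise I U V"
    and "noise (insert i I) U (insert i V) = 1/4 * noise I U V"
    and "noise (insert i I) (insert i U) (insert i V) = 3/4 * noise I U V"
proof -
  have 1: "(\<Prod>j\<in>I. if (j \<in> A) = (j \<in> B) then 3/4 else 1/4 :: real) = noise I U V"
    if "A \<inter> I = U \<inter> I" "B \<inter> I = V \<inter> I" for A B
    unfolding noise_def using that by (intro prod.cong) auto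
  have "i \<notin> U" "i \<notin> V" using assms by auto
  then show "noise (insert i I) U V = 3/4 * noise I U V"
    "noise (insert i I) (insert i U) V = 1/4 * noise I U V"
    "noise (insert i I) U (insert i V) = 1/4 * noise I U V"
    "noise (insert i I) (insert i U) (insert i V) = 3/4 * noise I U V"
    using assms(1,2) unfolding noise_def[of "insert i I"]
    by (simp_all add: 1 del: insert_iff) (simp_all add: 1)
qed

text \<open>One more coordinate tensors the operator with the two-by-two matrix with entries 3/4 and
  1/4. This drives the induction on the dimension.\<close>

lemma smooth_insert:
  assumes "finite I" "i \<notin> I" "U \<subseteq> I"
  shows "smooth (insert i I) f U = 3/4 * smooth I f U + 1/4 * smooth I (\<lambda>V. f (insert i V)) U"
    and "smooth (insert i I) f (insert i U) = 1/4 * smooth I f U + 3/4 * smooth I (\<lambda>V. f (insert i V)) U"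
  unfolding smooth_def sum_Pow_insert[OF assms(1,2)] sum_distrib_left
  using assms by (auto intro!: arg_cong2[where f = "(+)"] sum.cong simp: noise_insert)

section \<open>Hypercontractivity and its consequences for functions of small mean\<close>

text \<open>The (2,4)-hypercontractive inequality with sums instead of averages, which accounts for
  the power of two. Induction on the dimension splits \<open>f\<close> along the new coordinate into
  an even part \<open>p\<close> and an odd part \<open>q\<close>; the operator halves the odd part,
  which pays for the mixed terms of the fourth power.\<close>

lemma smooth_hypercontractive:
  assumes "finite I"
  shows "2 ^ card I * (\<Sum>U\<in>Pow I. smooth I f U ^ 4) \<le> (\<Sum>U\<in>Pow I. f U ^ 2)\<^sup>2"
  using assms
proof (induction I arbitrary: f)
  case empty
  then show ?case by (simp add: smooth_def noise_def)
next
  case (insert i I)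
  define p where "p V = (1/2) * (f V + f (insert i V))" for V
  define q where "q V = (1/2) * (f V + (-1) * f (insert i V))" for V
  define P where "P = smooth I p"
  define Q where "Q = smooth I q"
  define a where "a = (\<Sum>U\<in>Pow I. (p U)\<^sup>2)"
  define b where "b = (\<Sum>U\<in>Pow I. (q U)\<^sup>2)"
  define c :: real where "c = 2 ^ card I"
  define s4 where "s4 g = (\<Sum>U\<in>Pow I. g U ^ 4)" for g :: "'a set \<Rightarrow> real"
  define s22 where "s22 = (\<Sum>U\<in>Pow I. (P U)\<^sup>2 * (Q U)\<^sup>2)"
  have c: "c > 0" by (simp add: c_def)
  have a: "a \<ge> 0" "b \<ge> 0" by (auto simp: a_def b_def intro: sum_nonneg)
  have P4: "c * s4 P \<le> a\<^sup>2" and Q4: "c * s4 Q \<le> b\<^sup>2"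
    using insert.IH by (auto simp: c_def s4_def P_def Q_def a_def b_def)
  have s0: "s4 P \<ge> 0" "s4 Q \<ge> 0" "s22 \<ge> 0"
    by (auto simp: s4_def s22_def intro!: sum_nonneg)
  \<comment> \<open>Cauchy-Schwarz reduces the mixed term to the two fourth moments, both bounded by
    the induction hypothesis.\<close>
  have PQ: "c * s22 \<le> a * b"
  proof (rule power2_le_imp_le)
    have "s22\<^sup>2 \<le> s4 P * s4 Q"
      using Cauchy_Schwarz_ineq_sum[of "\<lambda>U. (P U)\<^sup>2" "\<lambda>U. (Q U)\<^sup>2" "Pow I"]
      by (simp add: s22_def s4_def flip: power_mult)
    then have "(c * s22)\<^sup>2 \<le> (c * s4 P) * (c * s4 Q)"
      using c by (simp add: power2_eq_square mult_ac)
    also have "\<dots> \<le> a\<^sup>2 * b\<^sup>2"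
      using P4 Q4 c s0 by (intro mult_mono) auto
    finally show "(c * s22)\<^sup>2 \<le> (a * b)\<^sup>2" by (simp add: power_mult_distrib)
  qed (use a in simp)
  have PQ_eq: "P U = (1/2) * (smooth I f U + smooth I (\<lambda>V. f (insert i V)) U)"
    "Q U = (1/2) * (smooth I f U + (-1) * smooth I (\<lambda>V. f (insert i V)) U)" for U
    unfolding P_def Q_def p_def[abs_def] q_def[abs_def] by (simp_all only: smooth_cmult smooth_add)
  have L: "smooth (insert i I) f U = P U + Q U / 2"
    "smooth (insert i I) f (insert i U) = P U - Q U / 2" if "U \<in> Pow I" for U
    using that insert.hyps
    by (auto simp: smooth_insert PQ_eq field_simps)
  have "(\<Sum>U\<in>Pow (insert i I). smooth (insert i I) f U ^ 4)
      = (\<Sum>U\<in>Pow I. (P U + Q U / 2) ^ 4) + (\<Sum>U\<in>Pow I. (P U - Q U / 2) ^ 4)"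
    unfolding sum_Pow_insert[OF insert.hyps] by (intro arg_cong2[where f = "(+)"] sum.cong) (auto simp: L)
  also have "\<dots> = (\<Sum>U\<in>Pow I. 2 * P U ^ 4 + 3 * ((P U)\<^sup>2 * (Q U)\<^sup>2) + 1/8 * Q U ^ 4)"
    unfolding sum.distrib[symmetric]
    by (intro sum.cong refl) (simp add: power4_eq_xxxx power2_eq_square field_simps)
  also have "\<dots> = 2 * s4 P + 3 * s22 + 1/8 * s4 Q"
    by (simp only: sum.distrib sum_distrib_left[symmetric] s4_def s22_def)
  \<comment> \<open>The coefficients are raised to 2, 4, 2 so that the bound becomes the perfect
    square of \<open>2 * (a + b)\<close>. Correlation \<open>r\<close> gives the mixed coefficient
    \<open>12 * r^2\<close>, which is 3 here and stays below 4.\<close>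
  also have "\<dots> \<le> 2 * s4 P + 4 * s22 + 2 * s4 Q" using s0 by simp
  finally have "2 * c * (\<Sum>U\<in>Pow (insert i I). smooth (insert i I) f U ^ 4)
      \<le> 2 * c * (2 * s4 P + 4 * s22 + 2 * s4 Q)"
    using c by simp
  also have "\<dots> \<le> (2 * (a + b))\<^sup>2"
    using P4 Q4 PQ by (simp add: power2_eq_square algebra_simps)
  also have "2 * (a + b) = (\<Sum>U\<in>Pow (insert i I). (f U)\<^sup>2)"
  proof -
    have "2 * (a + b) = (\<Sum>U\<in>Pow I. 2 * ((p U)\<^sup>2 + (q U)\<^sup>2))"
      by (simp add: a_def b_def sum.distrib sum_distrib_left)
    also have "\<dots> = (\<Sum>U\<in>Pow I. (f U)\<^sup>2 + (f (insert i U))\<^sup>2)"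
      by (intro sum.cong refl) (simp add: p_def q_def power2_eq_square field_simps)
    finally show ?thesis by (simp add: sum_Pow_insert[OF insert.hyps] sum.distrib)
  qed
  finally show ?case using insert.hyps by (simp add: c_def)
qed

text \<open>A case of Hoelder's inequality with exponents 4/3 and 4, obtained from two applications
  of Cauchy-Schwarz with weight \<open>A\<close>. The bound \<open>A x \<le> 1\<close> removes the
  weight left on the fourth powers.\<close>

lemma sum_weighted_power4:
  fixes A h :: "'b \<Rightarrow> real"
  assumes A: "\<And>x. x \<in> X \<Longrightarrow> 0 \<le> A x" "\<And>x. x \<in> X \<Longrightarrow> A x \<le> 1"
  shows "(\<Sum>x\<in>X. A x * h x) ^ 4 \<le> (\<Sum>x\<in>X. A x) ^ 3 * (\<Sum>x\<in>X. h x ^ 4)"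
proof -
  have CS: "(\<Sum>x\<in>X. A x * g x)\<^sup>2 \<le> (\<Sum>x\<in>X. A x) * (\<Sum>x\<in>X. A x * (g x)\<^sup>2)" for g
  proof -
    have "(\<Sum>x\<in>X. sqrt (A x) * (sqrt (A x) * g x))\<^sup>2
        \<le> (\<Sum>x\<in>X. (sqrt (A x))\<^sup>2) * (\<Sum>x\<in>X. (sqrt (A x) * g x)\<^sup>2)"
      by (rule Cauchy_Schwarz_ineq_sum)
    moreover have "(\<Sum>x\<in>X. sqrt (A x) * (sqrt (A x) * g x)) = (\<Sum>x\<in>X. A x * g x)"
      "(\<Sum>x\<in>X. (sqrt (A x))\<^sup>2) = (\<Sum>x\<in>X. A x)"
      "(\<Sum>x\<in>X. (sqrt (A x) * g x)\<^sup>2) = (\<Sum>x\<in>X. A x * (g x)\<^sup>2)"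
      using A(1) by (auto intro!: sum.cong simp: power_mult_distrib simp flip: mult.assoc)
    ultimately show ?thesis by simp
  qed
  have S0: "0 \<le> (\<Sum>x\<in>X. A x)" using A(1) by (rule sum_nonneg)
  have "(\<Sum>x\<in>X. A x * h x) ^ 4 = ((\<Sum>x\<in>X. A x * h x)\<^sup>2)\<^sup>2" by simp
  also have "\<dots> \<le> ((\<Sum>x\<in>X. A x) * (\<Sum>x\<in>X. A x * (h x)\<^sup>2))\<^sup>2"
    by (rule power_mono[OF CS]) simp
  also have "\<dots> = (\<Sum>x\<in>X. A x)\<^sup>2 * (\<Sum>x\<in>X. A x * (h x)\<^sup>2)\<^sup>2"
    by (rule power_mult_distrib)
  also have "\<dots> \<le> (\<Sum>x\<in>X. A x)\<^sup>2 * ((\<Sum>x\<in>X. A x) * (\<Sum>x\<in>X. A x * ((h x)\<^sup>2)\<^sup>2))"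
    by (rule mult_left_mono[OF CS]) simp
  also have "\<dots> = (\<Sum>x\<in>X. A x) ^ 3 * (\<Sum>x\<in>X. A x * h x ^ 4)"
    by (simp add: power2_eq_square power3_eq_cube power4_eq_xxxx mult_ac)
  also have "\<dots> \<le> (\<Sum>x\<in>X. A x) ^ 3 * (\<Sum>x\<in>X. h x ^ 4)"
    using A S0 by (intro mult_left_mono sum_mono mult_left_le_one_le) auto
  finally show ?thesis .
qed

text \<open>In averages: a function with values in [0,1] and mean \<open>u\<close> has a smoothed
  version with second moment at most \<open>u\<close> to the power 3/2. Self-adjointness turns the
  second moment \<open>X\<close> into a pairing of \<open>A\<close> with its double smoothing;
  Hoelder and hypercontractivity applied to \<open>smooth I A\<close> bound \<open>X ^ 4\<close> by
  a multiple of \<open>X\<^sup>2\<close>, which is cancelled.\<close>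

lemma sum_smooth_square_le:
  assumes I: "finite I"
    and A: "\<And>U. U \<in> Pow I \<Longrightarrow> 0 \<le> A U" "\<And>U. U \<in> Pow I \<Longrightarrow> A U \<le> 1"
  shows "2 ^ card I * (\<Sum>U\<in>Pow I. (smooth I A U)\<^sup>2)\<^sup>2 \<le> (\<Sum>U\<in>Pow I. A U) ^ 3"
proof -
  define X where "X = (\<Sum>U\<in>Pow I. (smooth I A U)\<^sup>2)"
  define s where "s = (\<Sum>U\<in>Pow I. A U)"
  have s: "s \<ge> 0" using A(1) by (auto simp: s_def intro: sum_nonneg)
  have "X = (\<Sum>U\<in>Pow I. A U * smooth I (smooth I A) U)"
    by (simp add: X_def smooth_self_adjoint power2_eq_square)
  then have "X ^ 4 \<le> s ^ 3 * (\<Sum>U\<in>Pow I. smooth I (smooth I A) U ^ 4)"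
    using sum_weighted_power4[of "Pow I" A] A by (simp add: s_def)
  then have "2 ^ card I * X ^ 4 \<le> s ^ 3 * (2 ^ card I * (\<Sum>U\<in>Pow I. smooth I (smooth I A) U ^ 4))"
    by (simp add: mult_ac)
  also have "\<dots> \<le> s ^ 3 * X\<^sup>2"
    unfolding X_def using s by (intro mult_left_mono smooth_hypercontractive[OF I]) auto
  finally have "X\<^sup>2 * (2 ^ card I * X\<^sup>2) \<le> X\<^sup>2 * s ^ 3"
    by (simp add: mult_ac power2_eq_square power4_eq_xxxx)
  then show ?thesis
    using s by (cases "X = 0") (auto simp: X_def[symmetric] s_def[symmetric])
qed

lemma sum_smooth_mult_le:
  assumes I: "finite I" and r: "r > 0"
    and A: "\<And>U. U \<in> Pow I \<Longrightarrow> 0 \<le> A U" "\<And>U. U \<in> Pow I \<Longrightarrow> A U \<le> 1" "(\<Sum>U\<in>Pow I. A U) \<le> 2 ^ card I / r"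
    and B: "\<And>U. U \<in> Pow I \<Longrightarrow> 0 \<le> B U" "\<And>U. U \<in> Pow I \<Longrightarrow> B U \<le> 1" "(\<Sum>U\<in>Pow I. B U) \<le> 2 ^ card I / r"
  shows "(\<Sum>U\<in>Pow I. smooth I A U * smooth I B U) \<le> 2 ^ card I / (r * sqrt r)"
proof -
  have key: "(\<Sum>U\<in>Pow I. (smooth I A U)\<^sup>2) \<le> 2 ^ card I / (r * sqrt r)"
    if A: "\<And>U. U \<in> Pow I \<Longrightarrow> 0 \<le> A U" "\<And>U. U \<in> Pow I \<Longrightarrow> A U \<le> 1" "(\<Sum>U\<in>Pow I. A U) \<le> 2 ^ card I / r"
    for A :: "'a set \<Rightarrow> real"
  proof (rule power2_le_imp_le)
    have "2 ^ card I * (\<Sum>U\<in>Pow I. (smooth I A U)\<^sup>2)\<^sup>2 \<le> (\<Sum>U\<in>Pow I. A U) ^ 3"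
      by (rule sum_smooth_square_le[OF I A(1,2)])
    also have "\<dots> \<le> (2 ^ card I / r) ^ 3"
      using A by (intro power_mono sum_nonneg) auto
    also have "\<dots> = 2 ^ card I * (2 ^ card I / (r * sqrt r))\<^sup>2"
    proof -
      have r3: "(r * sqrt r)\<^sup>2 = r ^ 3"
        using r by (simp add: power_mult_distrib power3_eq_cube power2_eq_square[of r])
      show ?thesis
        unfolding power_divide r3 by (simp add: power2_eq_square power3_eq_cube)
    qed
    finally show "(\<Sum>U\<in>Pow I. (smooth I A U)\<^sup>2)\<^sup>2 \<le> (2 ^ card I / (r * sqrt r))\<^sup>2"
      by simp
  qed (use r in simp)
  have kA: "(\<Sum>U\<in>Pow I. (smooth I A U)\<^sup>2) \<le> 2 ^ card I / (r * sqrt r)"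
    by (rule key) (fact A)+
  have kB: "(\<Sum>U\<in>Pow I. (smooth I B U)\<^sup>2) \<le> 2 ^ card I / (r * sqrt r)"
    by (rule key) (fact B)+
  \<comment> \<open>The product of two different functions is reduced to squares by the
    arithmetic-geometric mean inequality.\<close>
  have "(\<Sum>U\<in>Pow I. smooth I A U * smooth I B U)
      \<le> (\<Sum>U\<in>Pow I. ((smooth I A U)\<^sup>2 + (smooth I B U)\<^sup>2) / 2)"
    using sum_squares_bound[of "smooth I A _" "smooth I B _"]
    by (intro sum_mono) (simp add: mult_ac)
  also have "\<dots> = ((\<Sum>U\<in>Pow I. (smooth I A U)\<^sup>2) + (\<Sum>U\<in>Pow I. (smooth I B U)\<^sup>2)) / 2"
    by (simp add: sum.distrib flip: sum_divide_distrib)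
  also have "\<dots> \<le> 2 ^ card I / (r * sqrt r)"
    using add_mono[OF kA kB] by (simp only: field_sum_of_halves pos_divide_le_eq zero_less_numeral mult_2_right)
  finally show ?thesis .
qed

text \<open>For independent noisy copies \<open>U\<close>, \<open>V\<close> of \<open>W\<close>,
  each coordinate contributes (1/2)(1/2) to the mean of the inner product, so that mean is a quarter
  of the dimension. The second moment is at least the square of the mean.\<close>

lemma noise_inner_product_square:
  assumes I: "finite I"
  shows "(\<Sum>U\<in>Pow I. \<Sum>V\<in>Pow I. noise I W U * noise I W V * (\<Sum>i\<in>I. sign_at U i * sign_at V i)\<^sup>2)
     \<ge> (real (card I))\<^sup>2 / 16"
proof -
  define c where "c = real (card I) / 4"
  define k where "k U V = noise I W U * noise I W V" for U V
  define z where "z U V = (\<Sum>i\<in>I. sign_at U i * sign_at V i)" for U V :: "'a set"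
  have 1: "(\<Sum>U\<in>Pow I. \<Sum>V\<in>Pow I. k U V) = 1"
    by (simp add: k_def sum_noise[OF I] flip: sum_distrib_left)
  have "(\<Sum>U\<in>Pow I. \<Sum>V\<in>Pow I. k U V * z U V)
      = (\<Sum>U\<in>Pow I. \<Sum>V\<in>Pow I. \<Sum>i\<in>I. (noise I W U * sign_at U i) * (noise I W V * sign_at V i))"
    by (simp add: k_def z_def sum_distrib_left mult_ac)
  also have "\<dots> = (\<Sum>U\<in>Pow I. \<Sum>i\<in>I. \<Sum>V\<in>Pow I. (noise I W U * sign_at U i) * (noise I W V * sign_at V i))"
    by (intro sum.cong refl sum.swap)
  also have "\<dots> = (\<Sum>i\<in>I. \<Sum>U\<in>Pow I. \<Sum>V\<in>Pow I. (noise I W U * sign_at U i) * (noise I W V * sign_at V i))"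
    by (rule sum.swap)
  also have "\<dots> = (\<Sum>i\<in>I. 1/4)"
  proof (intro sum.cong refl)
    fix i assume i: "i \<in> I"
    have "(\<Sum>U\<in>Pow I. \<Sum>V\<in>Pow I. (noise I W U * sign_at U i) * (noise I W V * sign_at V i))
        = (sign_at W i / 2) * (sign_at W i / 2)"
      by (simp add: sum_noise_sign[OF I i] flip: sum_product)
    then show "(\<Sum>U\<in>Pow I. \<Sum>V\<in>Pow I. (noise I W U * sign_at U i) * (noise I W V * sign_at V i)) = 1/4"
      by (simp add: sign_at_def split: if_splits)
  qed
  finally have 2: "(\<Sum>U\<in>Pow I. \<Sum>V\<in>Pow I. k U V * z U V) = c" by (simp add: c_def)
  \<comment> \<open>Jensen's inequality for the square, through its tangent line at the mean
    \<open>c\<close>.\<close>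
  have "c\<^sup>2 = 2 * c * (\<Sum>U\<in>Pow I. \<Sum>V\<in>Pow I. k U V * z U V) - c\<^sup>2 * (\<Sum>U\<in>Pow I. \<Sum>V\<in>Pow I. k U V)"
    unfolding 1 2 by (simp add: power2_eq_square)
  also have "\<dots> = (\<Sum>U\<in>Pow I. \<Sum>V\<in>Pow I. k U V * (2 * c * z U V - c\<^sup>2))"
    by (simp add: sum_distrib_left sum_distrib_right sum_subtractf algebra_simps)
  also have "\<dots> \<le> (\<Sum>U\<in>Pow I. \<Sum>V\<in>Pow I. k U V * (z U V)\<^sup>2)"
  proof (intro sum_mono mult_left_mono)
    show "2 * c * z U V - c\<^sup>2 \<le> (z U V)\<^sup>2" for U V
      using zero_le_power2[of "z U V - c"] by (simp add: power2_diff algebra_simps)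
  qed (simp add: k_def noise_nonneg)
  finally show ?thesis by (simp add: k_def z_def c_def power_divide)
qed

section \<open>Rank-one operators\<close>

text \<open>The operator that multiplies a column vector by its transpose. All vectors used are
  real, so no conjugate appears.\<close>

definition rank1 :: "nat \<Rightarrow> (nat \<Rightarrow> real) \<Rightarrow> complex mat" where
  "rank1 d v = mat d d (\<lambda>(i, j). complex_of_real (v i * v j))"

lemma rank1_carrier: "rank1 d v \<in> carrier_mat d d"
  by (simp add: rank1_def)

lemma psd_rank1: "psd_mat d (rank1 d v)"
  unfolding psd_mat_def
proof (intro conjI ballI)
  fix w :: "complex vec" assume w: "w \<in> carrier_vec d"
  define s where "s = (\<Sum>j<d. complex_of_real (v j) * w $ j)"
  have "(rank1 d v *\<^sub>v w) $ i = complex_of_real (v i) * s" if "i < d" for i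
    using that w by (simp add: rank1_def s_def scalar_prod_def sum_distrib_left mult_ac atLeast0LessThan)
  then have "(rank1 d v *\<^sub>v w) \<bullet>c w = (\<Sum>i<d. complex_of_real (v i) * s * cnj (w $ i))"
    using w by (simp add: scalar_prod_def atLeast0LessThan)
  also have "\<dots> = s * cnj s"
    by (simp add: s_def sum_distrib_left mult_ac)
  also have "\<dots> \<ge> 0"
    by (simp add: complex_mult_cnj less_eq_complex_def)
  finally show "0 \<le> (rank1 d v *\<^sub>v w) \<bullet>c w" .
qed (rule rank1_carrier)

lemma mat_trace_rank1: "mat_trace (rank1 d v) = complex_of_real (\<Sum>i<d. (v i)\<^sup>2)"
  by (simp add: mat_trace_def rank1_def power2_eq_square)

lemma mat_trace_rank1_mult:
  "mat_trace (rank1 d u * rank1 d v) = complex_of_real ((\<Sum>i<d. u i * v i)\<^sup>2)"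
proof -
  have "mat_trace (rank1 d u * rank1 d v)
      = complex_of_real (\<Sum>i<d. \<Sum>j<d. (u i * u j) * (v j * v i))"
    by (simp add: mat_trace_def rank1_def scalar_prod_def atLeast0LessThan)
  also have "(\<Sum>i<d. \<Sum>j<d. (u i * u j) * (v j * v i)) = (\<Sum>i<d. u i * v i)\<^sup>2"
    by (simp add: power2_eq_square sum_product mult_ac)
  finally show ?thesis .
qed

text \<open>The Kronecker product of rank-one operators belongs to the tensor product of the
  vectors, so joint outcome probabilities become squared inner products with the state
  vector.\<close>

lemma kron_rank1:
  "kron (rank1 d u) (rank1 d' w) = rank1 (d * d') (\<lambda>p. u (p div d') * w (p mod d'))"
proof (cases "d' = 0")
  case False
  then show ?thesis
    by (intro eq_matI) (auto simp: kron_def rank1_def less_mult_imp_div_less)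
qed (auto simp: kron_def rank1_def)

lemma sum_div_mod:
  fixes g :: "nat \<Rightarrow> nat \<Rightarrow> 'a::comm_monoid_add"
  shows "(\<Sum>p<n * k. g (p div k) (p mod k)) = (\<Sum>i<n. \<Sum>j<k. g i j)"
proof (cases "k = 0")
  case False
  have "i * k + j < n * k" if "i < n" "j < k" for i j
  proof -
    have "i * k + j < Suc i * k" using that by simp
    also have "\<dots> \<le> n * k" using that by (intro mult_le_mono) auto
    finally show ?thesis .
  qed
  then show ?thesis
    unfolding sum.cartesian_product using False
    by (intro sum.reindex_bij_witness[where i = "\<lambda>(i, j). i * k + j" and j = "\<lambda>p. (p div k, p mod k)"])
      (auto simp: less_mult_imp_div_less)
qed simp


section \<open>The game\<close>

lemma sum_lessThan_add:
  fixes f :: "nat \<Rightarrow> 'a::comm_monoid_add"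
  shows "(\<Sum>a<n + k. f a) = (\<Sum>a<n. f a) + (\<Sum>a<k. f (n + a))"
  by (induction k) (auto simp: add.assoc)

text \<open>Sylvester's doubling: four copies of \<open>H\<close> in a block matrix, the last one
  negated. The sign condition covers all indices, so it can later be applied without range
  conditions.\<close>

lemma sylvester_hadamard:
  "\<exists>H :: nat \<Rightarrow> nat \<Rightarrow> real. (\<forall>i a. H i a \<in> {-1, 1}) \<and>
     (\<forall>i<2 ^ l. \<forall>j<2 ^ l. (\<Sum>a<2 ^ l. H i a * H j a) = (if i = j then real (2 ^ l) else 0))"
proof (induction l)
  case 0
  show ?case by (intro exI[of _ "\<lambda>_ _. 1"]) auto
next
  case (Suc l)
  then obtain H :: "nat \<Rightarrow> nat \<Rightarrow> real" where H: "\<And>i a. H i a \<in> {-1, 1}"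
    and orth: "\<And>i j. i < 2 ^ l \<Longrightarrow> j < 2 ^ l \<Longrightarrow> (\<Sum>a<2 ^ l. H i a * H j a) = (if i = j then real (2 ^ l) else 0)"
    by blast
  define m :: nat where "m = 2 ^ l"
  have m: "m > 0" by (simp add: m_def)
  define e :: "nat \<Rightarrow> real" where "e i = (if m \<le> i then -1 else 1)" for i
  define G where "G i a = H (i mod m) (a mod m) * (if m \<le> a then e i else 1)" for i a
  have "(\<Sum>a<2 ^ Suc l. G i a * G j a) = (if i = j then real (2 ^ Suc l) else 0)"
    if ij: "i < 2 ^ Suc l" "j < 2 ^ Suc l" for i j
  proof -
    have "(\<Sum>a<2 ^ Suc l. G i a * G j a) = (\<Sum>a<m + m. G i a * G j a)"
      by (simp add: m_def mult_2)
    also have "\<dots> = (\<Sum>a<m. H (i mod m) a * H (j mod m) a)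
        + (\<Sum>a<m. e i * e j * (H (i mod m) a * H (j mod m) a))"
      unfolding sum_lessThan_add by (intro arg_cong2[where f = "(+)"] sum.cong) (auto simp: G_def)
    \<comment> \<open>The factor is 0 for rows in different halves and 2 for rows in the same
      half.\<close>
    also have "\<dots> = (1 + e i * e j) * (\<Sum>a<m. H (i mod m) a * H (j mod m) a)"
      by (simp only: distrib_right mult_1 sum_distrib_left sum.distrib)
    also have "(\<Sum>a<m. H (i mod m) a * H (j mod m) a) = (if i mod m = j mod m then 2 ^ l else 0)"
      using orth[of "i mod m" "j mod m"] m by (simp add: m_def)
    also have "(1 + e i * e j) * (if i mod m = j mod m then 2 ^ l else 0) = (if i = j then real (2 ^ Suc l) else 0)"
    proof -
      have "k mod m = (if m \<le> k then k - m else k)" if "k < 2 ^ Suc l" for k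
        using that m by (auto simp: m_def mod_if)
      then show ?thesis using ij by (auto simp: e_def)
    qed
    finally show ?thesis .
  qed
  moreover have "G i a \<in> {-1, 1}" for i a
    using H[of "i mod m" "a mod m"] by (auto simp: G_def e_def)
  ultimately show ?case by (intro exI[of _ G]) blast
qed

text \<open>
  Subsets of \<open>{..<m}\<close> stand for vertices of the cube, and \<open>e\<close> numbers them as questions. Output
  \<open>Suc a\<close> on question \<open>U\<close> claims that the vertex before the displacement by row \<open>a\<close> was \<open>shift U a\<close>.
\<close>

locale hadamard_game =
  fixes m n N :: nat and H :: "nat \<Rightarrow> nat \<Rightarrow> real" and e :: "nat set \<Rightarrow> nat"
  assumes m_pos: "0 < m" and m_le: "m \<le> n"
    and H_sign: "\<And>i a. H i a \<in> {-1, 1}"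
    and H_orth: "\<And>i j. i < m \<Longrightarrow> j < m \<Longrightarrow> (\<Sum>a<m. H i a * H j a) = (if i = j then real m else 0)"
    and e_inj: "inj_on e (Pow {..<m})"
    and e_range: "e ` Pow {..<m} \<subseteq> {1..N}"
begin

text \<open>In terms of \<open>sign_at\<close>, entrywise multiplication by the sign vector
  \<open>\<lambda>i. H i a\<close>, hence an involution of the cube.\<close>

definition shift :: "nat set \<Rightarrow> nat \<Rightarrow> nat set" where
  "shift U a = {i \<in> {..<m}. (i \<in> U) \<noteq> (H i a = -1)}"

lemma shift_Pow: "shift U a \<in> Pow {..<m}"
  by (auto simp: shift_def)

lemma e_shift: "e (shift U a) \<in> {1..N}"
  using e_range shift_Pow by blast

lemma shift_shift: "U \<in> Pow {..<m} \<Longrightarrow> shift (shift U a) a = U"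
  by (auto simp: shift_def)

lemma sign_at_shift: "i < m \<Longrightarrow> sign_at (shift U a) i = sign_at U i * H i a"
  using H_sign[of i a] by (auto simp: shift_def sign_at_def)

lemma sum_shift: "(\<Sum>U\<in>Pow {..<m}. f (shift U a)) = (\<Sum>U\<in>Pow {..<m}. f U)"
  by (rule sum.reindex_bij_witness[where i = "\<lambda>U. shift U a" and j = "\<lambda>U. shift U a"])
    (auto simp: shift_shift shift_Pow[unfolded Pow_iff])

section \<open>The quantum strategy\<close>

text \<open>
  The vectors with \<open>m \<le> c < n\<close> fill up the dimension to \<open>n\<close>; the one with \<open>c = n\<close> vanishes on
  \<open>{..<n}\<close> and gives a null output.
\<close>

definition basis_vec :: "nat \<Rightarrow> nat \<Rightarrow> nat \<Rightarrow> real" where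
  "basis_vec x c i = (if c < m then (if i < m then sign_at (inv_into (Pow {..<m}) e x) i * H i c / sqrt (real m) else 0)
     else of_bool (i = c))"

text \<open>The vectors with \<open>c < m\<close> resolve the identity on the first \<open>m\<close>
  coordinates: off the diagonal the sum vanishes by orthogonality, on it the question's signs square
  to 1. The remaining vectors are unit vectors.\<close>

lemma basis_vec_complete:
  assumes "i < n" "j < n"
  shows "(\<Sum>c<n + 1. basis_vec x c i * basis_vec x c j) = of_bool (i = j)"
proof -
  define s where "s = sign_at (inv_into (Pow {..<m}) e x)"
  have ss: "s k * s k = 1" for k by (simp add: s_def sign_at_def)
  have "{..<n + 1} = {..<m} \<union> {m..n}" using m_le by auto
  then have "(\<Sum>c<n + 1. basis_vec x c i * basis_vec x c j)
      = (\<Sum>c<m. basis_vec x c i * basis_vec x c j) + (\<Sum>c\<in>{m..n}. basis_vec x c i * basis_vec x c j)"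
    by (simp add: sum.union_disjoint ivl_disj_int)
  also have "(\<Sum>c<m. basis_vec x c i * basis_vec x c j) = of_bool (i = j \<and> i < m)"
  proof (cases "i < m \<and> j < m")
    case True
    then have "(\<Sum>c<m. basis_vec x c i * basis_vec x c j) = (\<Sum>c<m. s i * s j / real m * (H i c * H j c))"
      using m_pos by (intro sum.cong) (auto simp: basis_vec_def s_def)
    also have "\<dots> = s i * s j / real m * (\<Sum>c<m. H i c * H j c)"
      by (rule sum_distrib_left[symmetric])
    finally show ?thesis using True m_pos by (auto simp: H_orth ss)
  qed (auto simp: basis_vec_def)
  also have "(\<Sum>c\<in>{m..n}. basis_vec x c i * basis_vec x c j) = (\<Sum>c\<in>{m..n}. if c = i then of_bool (i = j) else 0)"
    by (intro sum.cong) (auto simp: basis_vec_def)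
  also have "\<dots> = of_bool (i = j \<and> m \<le> i)"
    using assms by auto
  finally show ?thesis by auto
qed

text \<open>The closed form of the outcome probabilities for the maximally entangled state on the
  first \<open>m\<close> coordinates. Outputs start at 1 and basis vectors at 0, hence
  \<open>a - 1\<close> and \<open>b - 1\<close>.\<close>

definition game_dist :: family where
  "game_dist a b x y = (\<Sum>i<m. basis_vec x (a - 1) i * basis_vec y (b - 1) i)\<^sup>2 / real m"

lemma povm_basis: "povm n (n + 1) (\<lambda>a. rank1 n (basis_vec x (a - 1)))"
proof -
  have "(\<Sum>a\<in>{1..n + 1}. rank1 n (basis_vec x (a - 1)) $$ (i, j)) = (if i = j then 1 else 0)"
    if "i < n" "j < n" for i j
  proof -
    have "(\<Sum>a\<in>{1..n + 1}. rank1 n (basis_vec x (a - 1)) $$ (i, j))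
        = complex_of_real (\<Sum>c<n + 1. basis_vec x c i * basis_vec x c j)"
      using that by (subst One_nat_def, subst sum.atLeast1_atMost_eq) (simp add: rank1_def)
    then show ?thesis unfolding basis_vec_complete[OF that] by simp
  qed
  then show ?thesis
    unfolding povm_def by (intro conjI ballI psd_rank1 eq_matI) auto
qed

text \<open>The number of inputs is arbitrary: for an input that is not the number of a vertex,
  \<open>inv_into\<close> has an unspecified value, but the signs taken from it are still 1 or -1
  and the measurement is still valid.\<close>

lemma quantum_game_dist: "quantum_dist N' (n + 1) n n game_dist"
proof -
  \<comment> \<open>The maximally entangled unit vector on the first \<open>m\<close> coordinates,
    flattened by the index convention of \<open>kron\<close>.\<close>
  define \<psi> where "\<psi> p = of_bool (p div n = p mod n \<and> p div n < m) / sqrt (real m)" for p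
  have sum_psi: "(\<Sum>p<n * n. g (p div n) (p mod n) * \<psi> p) = (\<Sum>i<m. g i i) / sqrt (real m)"
    for g :: "nat \<Rightarrow> nat \<Rightarrow> real"
  proof -
    have "(\<Sum>p<n * n. g (p div n) (p mod n) * \<psi> p)
        = (\<Sum>i<n. \<Sum>j<n. g i j * (of_bool (i = j \<and> i < m) / sqrt (real m)))"
      unfolding \<psi>_def by (rule sum_div_mod)
    also have "\<dots> = (\<Sum>i<n. \<Sum>j<n. if j = i then (if i < m then g i i / sqrt (real m) else 0) else 0)"
      by (intro sum.cong) auto
    also have "\<dots> = (\<Sum>i<n. if i < m then g i i / sqrt (real m) else 0)"
      by simp
    also have "\<dots> = (\<Sum>i\<in>{..<n} \<inter> {i. i < m}. g i i / sqrt (real m))"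
      by (simp add: sum.inter_restrict)
    also have "{..<n} \<inter> {i. i < m} = {..<m}" using m_le by auto
    finally show ?thesis by (simp add: sum_divide_distrib)
  qed
  have "(\<Sum>p<n * n. \<psi> p * \<psi> p) = (\<Sum>i<m. of_bool (i = i \<and> i < m) / sqrt (real m)) / sqrt (real m)"
    using sum_psi[of "\<lambda>i j. of_bool (i = j \<and> i < m) / sqrt (real m)"] by (simp only: \<psi>_def)
  also have "(\<Sum>i<m. of_bool (i = i \<and> i < m) / sqrt (real m)) = (\<Sum>i<m. 1 / sqrt (real m))"
    by (intro sum.cong) auto
  also have "\<dots> / sqrt (real m) = 1" using m_pos by simp
  finally have "density_mat (n * n) (rank1 (n * n) \<psi>)"
    by (simp only: density_mat_def psd_rank1 mat_trace_rank1 power2_eq_square of_real_1 simp_thms)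
  moreover have "complex_of_real (game_dist a b x y)
      = mat_trace (kron (rank1 n (basis_vec x (a - 1))) (rank1 n (basis_vec y (b - 1))) * rank1 (n * n) \<psi>)"
    for a b x y
    unfolding kron_rank1 mat_trace_rank1_mult
      sum_psi[of "\<lambda>i j. basis_vec x (a - 1) i * basis_vec y (b - 1) j"]
    by (simp add: game_dist_def power_divide)
  ultimately show ?thesis
    unfolding quantum_dist_def using povm_basis
    by (intro exI[of _ "\<lambda>x a. rank1 n (basis_vec x (a - 1))"] exI[of _ "rank1 (n * n) \<psi>"]) simp
qed

section \<open>The game value of quantum and of local distributions\<close>

text \<open>The winning probability, up to the factor \<open>2 ^ m * m\<^sup>2\<close>.\<close>

definition game_value :: "family \<Rightarrow> real" where
  "game_value Q = (\<Sum>W\<in>Pow {..<m}. \<Sum>U\<in>Pow {..<m}. \<Sum>V\<in>Pow {..<m}. noise {..<m} W U * noise {..<m} W V *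
     (\<Sum>a<m. \<Sum>b<m. Q (Suc a) (Suc b) (e (shift U a)) (e (shift V b))))"

lemma game_value_mix: "game_value (mix t Q R) = t * game_value Q + (1 - t) * game_value R"
  by (simp add: game_value_def mix_def sum.distrib sum_distrib_left distrib_left mult_ac)

lemma game_value_nonneg:
  assumes "\<And>a b x y. a < m \<Longrightarrow> b < m \<Longrightarrow> x \<in> {1..N} \<Longrightarrow> y \<in> {1..N} \<Longrightarrow> 0 \<le> Q (Suc a) (Suc b) x y"
  shows "0 \<le> game_value Q"
  unfolding game_value_def
  by (intro sum_nonneg mult_nonneg_nonneg noise_nonneg assms e_shift) auto

text \<open>The displacement cancels: on question \<open>shift U a\<close> the basis vector numbered
  \<open>a\<close> is the normalised sign vector of \<open>U\<close>. All \<open>m\<close> times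
  \<open>m\<close> correct answer pairs are thus equally likely, and their total is the squared
  inner product of the noisy copies over \<open>m\<close>.\<close>

lemma game_value_quantum:
  "game_value (extend_outputs (n + 1) game_dist) \<ge> 2 ^ m * real m / 16"
proof -
  have dist: "extend_outputs (n + 1) game_dist (Suc a) (Suc b) (e (shift U a)) (e (shift V b))
      = (\<Sum>i<m. sign_at U i * sign_at V i)\<^sup>2 / real m ^ 3" if "a < m" "b < m" for a b U V
  proof -
    have vec: "basis_vec (e (shift U a)) a i = sign_at U i / sqrt (real m)" if "i < m" "a < m" for U a i
      using that H_sign[of i a]
      by (auto simp: basis_vec_def inv_into_f_f[OF e_inj shift_Pow] sign_at_shift)
    have "(\<Sum>i<m. basis_vec (e (shift U a)) a i * basis_vec (e (shift V b)) b i)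
        = (\<Sum>i<m. sign_at U i * sign_at V i) / real m"
      unfolding sum_divide_distrib using m_pos that by (intro sum.cong) (auto simp: vec)
    then show ?thesis
      using that m_le by (simp add: extend_outputs_def game_dist_def power_divide power2_eq_square power3_eq_cube)
  qed
  have sum_dist: "(\<Sum>a<m. \<Sum>b<m. extend_outputs (n + 1) game_dist (Suc a) (Suc b) (e (shift U a)) (e (shift V b)))
      = (\<Sum>i<m. sign_at U i * sign_at V i)\<^sup>2 / real m" for U V
  proof -
    have "(\<Sum>a<m. \<Sum>b<m. extend_outputs (n + 1) game_dist (Suc a) (Suc b) (e (shift U a)) (e (shift V b)))
      = (\<Sum>a<m. \<Sum>b<m. (\<Sum>i<m. sign_at U i * sign_at V i)\<^sup>2 / real m ^ 3)"
      by (intro sum.cong refl dist) auto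
    also have "\<dots> = (\<Sum>i<m. sign_at U i * sign_at V i)\<^sup>2 / real m"
      using m_pos by (simp add: power3_eq_cube)
    finally show ?thesis .
  qed
  have "game_value (extend_outputs (n + 1) game_dist)
      = (\<Sum>W\<in>Pow {..<m}. \<Sum>U\<in>Pow {..<m}. \<Sum>V\<in>Pow {..<m}. noise {..<m} W U * noise {..<m} W V *
         ((\<Sum>i<m. sign_at U i * sign_at V i)\<^sup>2 / real m))"
    unfolding game_value_def sum_dist by (rule refl)
  also have "\<dots> = (\<Sum>W\<in>Pow {..<m}. (\<Sum>U\<in>Pow {..<m}. \<Sum>V\<in>Pow {..<m}. noise {..<m} W U * noise {..<m} W V *
         (\<Sum>i<m. sign_at U i * sign_at V i)\<^sup>2) / real m)"
    by (simp add: sum_divide_distrib)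
  also have "\<dots> \<ge> (\<Sum>W\<in>Pow {..<m}. ((real m)\<^sup>2 / 16) / real m)"
    using noise_inner_product_square[of "{..<m}"] by (intro sum_mono divide_right_mono) auto
  finally show ?thesis
    using m_pos by (simp add: card_Pow power2_eq_square)
qed

text \<open>\<open>A U\<close> is the chance of naming the correct displacement of \<open>U\<close>,
  averaged over displacements. As each displacement permutes the cube, summing over \<open>U\<close>
  first turns the total into one over undisplaced questions, where the outputs of one question have
  total probability at most 1. This gives mean at most \<open>1 / m\<close>.\<close>

lemma response_average:
  assumes R: "response M N K p" and \<omega>: "\<omega> \<in> space M" and K: "m \<le> K"
  defines "A \<equiv> \<lambda>U. (\<Sum>a<m. p (Suc a) (e (shift U a)) \<omega>) / real m"
  shows "0 \<le> A U" "A U \<le> 1" "(\<Sum>U\<in>Pow {..<m}. A U) \<le> 2 ^ m / real m"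
proof -
  have nn: "0 \<le> p a x \<omega>" if "a \<in> {1..K}" "x \<in> {1..N}" for a x
    using R \<omega> that by (auto simp: response_def)
  have le: "(\<Sum>a<m. p (Suc a) x \<omega>) \<le> 1" if "x \<in> {1..N}" for x
  proof -
    have "(\<Sum>a<m. p (Suc a) x \<omega>) = (\<Sum>a\<in>{1..m}. p a x \<omega>)"
      by (simp add: sum.atLeast1_atMost_eq)
    also have "\<dots> \<le> (\<Sum>a\<in>{1..K}. p a x \<omega>)"
      using nn that K by (intro sum_mono2) auto
    finally show ?thesis using R \<omega> that by (simp add: response_def)
  qed
  show "0 \<le> A U"
    unfolding A_def using nn e_shift K by (intro divide_nonneg_nonneg sum_nonneg) auto
  have "p (Suc a) (e (shift U a)) \<omega> \<le> 1" if "a < m" for a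
    using le[OF e_shift, of U a] member_le_sum[of a "{..<m}" "\<lambda>a'. p (Suc a') (e (shift U a)) \<omega>"]
      nn[OF _ e_shift] K that by fastforce
  then have "(\<Sum>a<m. p (Suc a) (e (shift U a)) \<omega>) \<le> (\<Sum>a<m. 1)"
    by (intro sum_mono) auto
  then show "A U \<le> 1" unfolding A_def using m_pos by simp
  have "(\<Sum>U\<in>Pow {..<m}. A U) = (\<Sum>a<m. \<Sum>U\<in>Pow {..<m}. p (Suc a) (e (shift U a)) \<omega>) / real m"
    unfolding A_def sum_divide_distrib[symmetric] by (subst sum.swap) (rule refl)
  also have "\<dots> = (\<Sum>a<m. \<Sum>U\<in>Pow {..<m}. p (Suc a) (e U) \<omega>) / real m"
    by (intro arg_cong2[where f = "(/)"] sum.cong refl sum_shift)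
  also have "\<dots> = (\<Sum>U\<in>Pow {..<m}. \<Sum>a<m. p (Suc a) (e U) \<omega>) / real m"
    by (subst sum.swap) (rule refl)
  also have "\<dots> \<le> (\<Sum>U\<in>Pow {..<m}. 1) / real m"
  proof (intro divide_right_mono sum_mono le)
    show "e U \<in> {1..N}" if "U \<in> Pow {..<m}" for U
      using e_range that by blast
  qed simp
  finally show "(\<Sum>U\<in>Pow {..<m}. A U) \<le> 2 ^ m / real m" by (simp add: card_Pow)
qed

text \<open>For each fixed sample point the strategies factor, and the value becomes the pairing of
  two smoothed functions of mean at most \<open>1 / m\<close>. The small-mean estimate holds
  pointwise and is then integrated.\<close>

lemma game_value_local:
  assumes L: "local_over M N K Q" and K: "m \<le> K"
  shows "game_value Q \<le> 2 ^ m * sqrt (real m)"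
proof -
  interpret prob_space M using L by (simp add: local_over_def)
  obtain p q where p: "response M N K p" and q: "response M N K q"
    and Q: "\<And>x y a b. x \<in> {1..N} \<Longrightarrow> y \<in> {1..N} \<Longrightarrow> a \<in> {1..K} \<Longrightarrow> b \<in> {1..K} \<Longrightarrow>
      Q a b x y = (\<integral>\<omega>. p a x \<omega> * q b y \<omega> \<partial>M)"
    using L by (auto simp: local_over_def)
  have le1: "r a x \<omega> \<le> 1" if "response M N K r" "a \<in> {1..K}" "x \<in> {1..N}" "\<omega> \<in> space M" for r a x \<omega>
    using that member_le_sum[of a "{1..K}" "\<lambda>a. r a x \<omega>"] by (force simp: response_def)
  \<comment> \<open>Integrability and value in one statement, so that the finite sums of the game
    pass through the integral together.\<close>
  have hbi: "has_bochner_integral M (\<lambda>\<omega>. p a x \<omega> * q b y \<omega>) (Q a b x y)"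
    if "x \<in> {1..N}" "y \<in> {1..N}" "a \<in> {1..K}" "b \<in> {1..K}" for a b x y
  proof -
    have "integrable M (\<lambda>\<omega>. p a x \<omega> * q b y \<omega>)"
    proof (rule integrable_const_bound[where B = 1])
      show "AE \<omega> in M. norm (p a x \<omega> * q b y \<omega>) \<le> 1"
        using le1[OF p that(3,1)] le1[OF q that(4,2)] p q that
        by (intro AE_I2) (auto simp: response_def abs_mult intro!: mult_le_one)
    qed (use p q that in \<open>auto simp: response_def intro!: borel_measurable_times\<close>)
    then show ?thesis unfolding Q[OF that] by (rule has_bochner_integral_integrable)
  qed
  define I where "I = {..<m}"
  define A where "A r \<omega> U = (\<Sum>a<m. r (Suc a) (e (shift U a)) \<omega>) / real m"
    for r :: "nat \<Rightarrow> nat \<Rightarrow> 'a \<Rightarrow> real" and \<omega> U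
  define g where "g \<omega> = (\<Sum>W\<in>Pow I. \<Sum>U\<in>Pow I. \<Sum>V\<in>Pow I. noise I W U * noise I W V *
     (\<Sum>a<m. \<Sum>b<m. p (Suc a) (e (shift U a)) \<omega> * q (Suc b) (e (shift V b)) \<omega>))" for \<omega>
  have "has_bochner_integral M g (game_value Q)"
    unfolding g_def[abs_def] game_value_def I_def[symmetric]
    using K by (intro has_bochner_integral_sum has_bochner_integral_mult_right hbi e_shift) (auto simp: I_def)
  moreover have "g \<omega> \<le> 2 ^ m * sqrt (real m)" if \<omega>: "\<omega> \<in> space M" for \<omega>
  proof -
    have "g \<omega> = (\<Sum>W\<in>Pow I. \<Sum>U\<in>Pow I. \<Sum>V\<in>Pow I. noise I W U * noise I W V *
        ((real m)\<^sup>2 * (A p \<omega> U * A q \<omega> V)))"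
      unfolding g_def A_def using m_pos
      by (intro sum.cong refl arg_cong2[where f = "(*)"]) (simp add: sum_product power2_eq_square)
    also have "\<dots> = (real m)\<^sup>2 * (\<Sum>W\<in>Pow I. smooth I (A p \<omega>) W * smooth I (A q \<omega>) W)"
      unfolding smooth_def sum_product sum_distrib_left[of "(real m)\<^sup>2"]
      by (intro sum.cong refl) (simp only: mult_ac)
    also have "\<dots> \<le> (real m)\<^sup>2 * (2 ^ card I / (real m * sqrt (real m)))"
      using response_average[OF p \<omega> K] response_average[OF q \<omega> K] m_pos
      by (intro mult_left_mono sum_smooth_mult_le) (auto simp: A_def[abs_def] I_def)
    also have "\<dots> = 2 ^ m * sqrt (real m)"
      using m_pos by (simp add: I_def power2_eq_square field_simps)
    finally show ?thesis .
  qed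
  ultimately show ?thesis
    using integral_le_const[of g "2 ^ m * sqrt (real m)"]
    by (auto simp: has_bochner_integral_iff)
qed

text \<open>The value of a mixture is at least \<open>t\<close> times the quantum value, as the
  noise contributes a nonnegative amount. The local bound then forces
  \<open>t \<le> 16 / sqrt (real m)\<close>.\<close>

lemma threshold_le:
  "nonlocal_threshold N (n + 2) (extend_outputs (n + 1) game_dist) \<le> 16 / sqrt (real m)"
proof -
  let ?P = "extend_outputs (n + 1) game_dist"
  define S where "S = {t \<in> {0..1}. \<forall>P'\<in>local_dists N (n + 2). mix t ?P P' \<notin> local_dists N (n + 2)}"
  have th: "nonlocal_threshold N (n + 2) ?P = (if S = {} then 1 else Inf S)"
    unfolding nonlocal_threshold_def S_def Let_def by (rule refl)
  have bdd: "bdd_below S" by (auto simp: S_def bdd_below_def)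
  have S: "t \<in> S" if t: "16 / sqrt (real m) < t" "t \<le> 1" for t
  proof -
    have t0: "0 \<le> t" using t by (meson divide_nonneg_nonneg less_imp_le order_trans real_sqrt_ge_zero of_nat_0_le_iff zero_le_numeral)
    have False if P': "P' \<in> local_dists N (n + 2)" and mixed: "mix t ?P P' \<in> local_dists N (n + 2)" for P'
    proof -
      have "0 \<le> game_value P'"
      proof (rule game_value_nonneg)
        fix a b x y assume "a < m" "b < m" "x \<in> {1..N}" "y \<in> {1..N}"
        then show "0 \<le> P' (Suc a) (Suc b) x y"
          using P' m_le by (auto simp: local_dists_def local_over_def response_def intro!: Bochner_Integration.integral_nonneg)
      qed
      then have "0 \<le> (1 - t) * game_value P'" using t by simp
      moreover have "t * (2 ^ m * real m / 16) \<le> t * game_value ?P"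
        using game_value_quantum t0 by (rule mult_left_mono)
      moreover have "game_value (mix t ?P P') \<le> 2 ^ m * sqrt (real m)"
        using mixed game_value_local m_le unfolding local_dists_def by fastforce
      ultimately have "t * (2 ^ m * real m / 16) \<le> 2 ^ m * sqrt (real m)"
        unfolding game_value_mix by linarith
      then have "t * real m \<le> 16 * sqrt (real m)" by (simp add: field_simps)
      then have "t * sqrt (real m) * sqrt (real m) \<le> 16 * sqrt (real m)" by (simp add: mult.assoc)
      then have "t * sqrt (real m) \<le> 16" using m_pos by simp
      then show False using t m_pos by (simp add: field_simps)
    qed
    then show ?thesis using t t0 by (auto simp: S_def)
  qed
  show ?thesis
  \<comment> \<open>If the bound is below 1, all larger \<open>t\<close> up to 1 lie in
    \<open>S\<close>, and the infimum is bounded by density. Otherwise the threshold is at most 1 in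
    any case, including the value 1 for empty \<open>S\<close>.\<close>
  proof (cases "16 / sqrt (real m) < 1")
    case True
    have "Inf S \<le> 16 / sqrt (real m)"
    proof (rule dense_ge_bounded[OF True])
      fix t assume "16 / sqrt (real m) < t" "t < 1"
      then show "Inf S \<le> t" by (intro cInf_lower S bdd) auto
    qed
    moreover have "S \<noteq> {}" using S[of 1] True by auto
    ultimately show ?thesis unfolding th by simp
  next
    case False
    have "Inf S \<le> 1" if "S \<noteq> {}"
      using that cInf_lower[OF _ bdd] by (fastforce simp: S_def)
    then show ?thesis using False unfolding th by (cases "S = {}") auto
  qed
qed

end

section \<open>Choice of the parameters for a given dimension\<close>

lemma two_le_nat_ceil:
  assumes "1 < x"
  shows "2 \<le> nat_ceil x"
proof -
  have "x \<le> real (nat_ceil x)"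
    unfolding nat_ceil_def by (rule LeastI_ex) (rule real_arch_simple)
  then show ?thesis using assms by linarith
qed

theorem corollary3:
  shows "\<exists>C::real. C > 0 \<and>
    (\<forall>n::nat. n \<ge> 2 \<longrightarrow>
      (\<exists>P. quantum_dist (nat_ceil (2 powr ((log 2 (real n))\<^sup>2 / 2)) ^ n) (n + 1) n n P \<and>
           nonlocal_threshold (nat_ceil (2 powr ((log 2 (real n))\<^sup>2 / 2)) ^ n) (n + 2)
             (extend_outputs (n + 1) P)
           \<le> C * ((log 2 (real n))\<^sup>2 / sqrt (real n))))"
\<comment> \<open>The constant 16 of the threshold bound doubles in passing from \<open>m\<close> to
  \<open>n\<close>.\<close>
proof (intro exI[of _ 32] conjI allI impI)
  fix n :: nat assume n: "2 \<le> n"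
  define N where "N = nat_ceil (2 powr ((log 2 (real n))\<^sup>2 / 2)) ^ n"
  have log1: "1 \<le> log 2 (real n)" using n by (simp add: le_log_iff)
  obtain l where l: "2 ^ l \<le> n" "n < 2 ^ Suc l"
    using ex_power_ivl1[of 2 n] n by (metis Suc_eq_plus1 le_refl le_trans one_le_numeral)
  define m :: nat where "m = 2 ^ l"
  have m: "0 < m" "m \<le> n" "n < 2 * m" using l by (auto simp: m_def)
  \<comment> \<open>The base of \<open>N\<close> is a rounded-up number above 1, hence at least 2.
    So \<open>N\<close> is at least \<open>2 ^ n\<close>, which leaves room for one question per
    vertex.\<close>
  have "1 < 2 powr ((log 2 (real n))\<^sup>2 / 2)" using log1 by simp
  then have "2 ^ n \<le> N" unfolding N_def by (intro power_mono two_le_nat_ceil) auto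
  moreover have "(2::nat) ^ m \<le> 2 ^ n" using m by (intro power_increasing) auto
  ultimately have N: "2 ^ m \<le> N" by (rule order_trans[rotated])
  obtain h where h: "bij_betw h (Pow {..<m}) {0..<card (Pow {..<m})}"
    using ex_bij_betw_finite_nat[of "Pow {..<m}"] by auto
  obtain H :: "nat \<Rightarrow> nat \<Rightarrow> real" where H: "\<forall>i a. H i a \<in> {-1, 1}"
    "\<forall>i<m. \<forall>j<m. (\<Sum>a<m. H i a * H j a) = (if i = j then real m else 0)"
    using sylvester_hadamard[of l, folded m_def] by (elim exE conjE)
  \<comment> \<open>\<open>h\<close> counts from 0 and inputs from 1, hence the
    \<open>Suc\<close>.\<close>
  interpret hadamard_game m n N H "\<lambda>U. Suc (h U)"
  proof
    show "inj_on (\<lambda>U. Suc (h U)) (Pow {..<m})"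
      using h by (auto simp: bij_betw_def inj_on_def)
    show "(\<lambda>U. Suc (h U)) ` Pow {..<m} \<subseteq> {1..N}"
    proof (intro image_subsetI)
      fix U assume "U \<in> Pow {..<m}"
      then have "h U < 2 ^ m" using bij_betw_apply[OF h] by (auto simp: card_Pow)
      then show "Suc (h U) \<in> {1..N}" using N by simp
    qed
  qed (use m H in simp_all)
  have "16 / sqrt (real m) \<le> 32 * (1 / sqrt (real n))"
  proof -
    \<comment> \<open>From \<open>n < 2 * m\<close>; the factor 4 is used because its square root is
      2.\<close>
    have "sqrt (real n) \<le> sqrt (4 * real m)" using m by simp
    then have "sqrt (real n) \<le> 2 * sqrt (real m)" by (simp add: real_sqrt_mult)
    then show ?thesis using m by (simp add: field_simps)
  qed
  also have "\<dots> \<le> 32 * ((log 2 (real n))\<^sup>2 / sqrt (real n))"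
    using log1 by (intro mult_left_mono divide_right_mono) (auto simp: one_le_power)
  finally have "nonlocal_threshold N (n + 2) (extend_outputs (n + 1) game_dist)
      \<le> 32 * ((log 2 (real n))\<^sup>2 / sqrt (real n))"
    using threshold_le by simp
  then show "\<exists>P. quantum_dist (nat_ceil (2 powr ((log 2 (real n))\<^sup>2 / 2)) ^ n) (n + 1) n n P \<and>
      nonlocal_threshold (nat_ceil (2 powr ((log 2 (real n))\<^sup>2 / 2)) ^ n) (n + 2) (extend_outputs (n + 1) P)
      \<le> 32 * ((log 2 (real n))\<^sup>2 / sqrt (real n))"
    using quantum_game_dist unfolding N_def by blast
qed simp

end
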